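(* Let $p_0$ and $p_1$ be two distributions on $\mathbb{R}^d$ (their densities are denoted by the same symbols), and let $\phi$ be an interpolant, i.e. a smooth enough family of maps $x_0\mapsto\phi_{t,x_1}(x_0)$ on $\mathbb{R}^d$, invertible in $x_0$ with inverse $\phi_{t,x_1}^{-1}$. Let $\mathcal{J}$ be the determinant of the Jacobian of the interpolant's inverse, i.e. the determinant of $\frac{d\,\phi_{t,x_1}^{-1}(x)}{dx}$ (at $x=x_t$). Then the optimal velocity field for the interpolant $\phi$ is given by $$v_\phi^*(t,x_t)=\frac{\displaystyle\int \partial_t\phi_{t,x_1}\big(\phi_{t,x_1}^{-1}(x_t)\big)\,p_0\big(\phi_{t,x_1}^{-1}(x_t)\big)\,|\mathcal{J}|\,p_1(x_1)\,dx_1}{\displaystyle\int p_0\big(\phi_{t,x_1}^{-1}(x_t)\big)\,|\mathcal{J}|\,p_1(x_1)\,dx_1}.$$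
   Context: $p_0$ is the source distribution and $p_1$ the target distribution; samples $x_0\sim p_0$ and $x_1\sim p_1$ are drawn independently, and $t\in[0,1]$ is drawn uniformly, independently of them. The interpolant defines the conditional path $x_t=\phi_{t,x_1}(x_0)$; for example, the linear interpolant is $\phi_{t,x_1}(x_0)=t x_1+(1-t)x_0$. The optimal velocity field for $\phi$ is the global minimizer over vector fields $v(t,x)$ of the conditional flow matching objective $$\mathbb{E}_{t,\,p_0(x_0),\,p_1(x_1)}\left\|v(t,x_t)-\partial_t\phi_{t,x_1}(x_0)\right\|_2^2 .$$ The expression $\partial_t\phi_{t,x_1}\big(\phi_{t,x_1}^{-1}(x_t)\big)$ means the partial derivative in $t$ of $\phi_{t,x_1}(y)$ with $y$ and $x_1$ held fixed, then evaluated at $y=\phi_{t,x_1}^{-1}(x_t)$. The Jacobian determinant $\mathcal{J}$ depends on $t$, $x_1$ and $x_t$. *)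

theory Defs
  imports "HOL-Analysis.Analysis"
begin

definition prob_density :: "('a::euclidean_space \<Rightarrow> real) \<Rightarrow> bool" where
  "prob_density p \<longleftrightarrow> p \<in> borel_measurable borel \<and> (\<forall>x. 0 \<le> p x) \<and>
     (\<integral>\<^sup>+ x. ennreal (p x) \<partial>lborel) = 1"

(* phi t x1 x0 stands for phi_{t,x1}(x0). Conditions are imposed only for 0 < t < 1: the linear
   interpolant t x1 + (1 - t) x0 is not invertible at t = 1, and the endpoints have probability 0.
   The regularity is the minimum that makes the time derivative, the Jacobian of the inverse and
   the integrals below meaningful; every jointly C^1 family with C^1 inverses satisfies it. *)
definition interpolant :: "(real \<Rightarrow> real^'d \<Rightarrow> real^'d \<Rightarrow> real^'d) \<Rightarrow> bool" where
  "interpolant \<phi> \<longleftrightarrow>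
     (\<forall>t\<in>{0<..<1}. \<forall>x1. bij (\<phi> t x1)) \<and>
     (\<forall>t\<in>{0<..<1}. \<forall>x1 x0. (\<lambda>s. \<phi> s x1 x0) differentiable (at t)) \<and>
     (\<forall>t\<in>{0<..<1}. \<forall>x1 x. inv (\<phi> t x1) differentiable (at x)) \<and>
     (\<lambda>(t, x1, x0). \<phi> t x1 x0) \<in> borel_measurable (restrict_space borel ({0<..<1} \<times> UNIV)) \<and>
     (\<lambda>(t, x1, x). inv (\<phi> t x1) x) \<in> borel_measurable (restrict_space borel ({0<..<1} \<times> UNIV))"

definition time_deriv :: "(real \<Rightarrow> real^'d \<Rightarrow> real^'d \<Rightarrow> real^'d) \<Rightarrow> real \<Rightarrow> real^'d \<Rightarrow> real^'d \<Rightarrow> real^'d" where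
  "time_deriv \<phi> t x1 y = vector_derivative (\<lambda>s. \<phi> s x1 y) (at t)"

definition inv_jacobian_det :: "(real \<Rightarrow> real^'d \<Rightarrow> real^'d \<Rightarrow> real^'d) \<Rightarrow> real \<Rightarrow> real^'d \<Rightarrow> real^'d \<Rightarrow> real" where
  "inv_jacobian_det \<phi> t x1 x = det (jacobian (inv (\<phi> t x1)) (at x))"

(* The joint law of (t, x0, x1): independent, with t uniform on [0,1]. *)
definition sample_law :: "(real^'d \<Rightarrow> real) \<Rightarrow> (real^'d \<Rightarrow> real) \<Rightarrow> (real \<times> (real^'d) \<times> (real^'d)) measure" where
  "sample_law p0 p1 = uniform_measure lborel {0..1} \<Otimes>\<^sub>M (density lborel p0 \<Otimes>\<^sub>M density lborel p1)"

(* Values at the endpoint times are unconstrained, as they do not affect the objective. *)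
definition vector_field :: "(real \<Rightarrow> real^'d \<Rightarrow> real^'d) \<Rightarrow> bool" where
  "vector_field v \<longleftrightarrow>
     (\<lambda>(t, x). v t x) \<in> borel_measurable (restrict_space borel ({0<..<1} \<times> UNIV))"

definition cfm_objective ::
  "(real \<Rightarrow> real^'d \<Rightarrow> real^'d \<Rightarrow> real^'d) \<Rightarrow> (real^'d \<Rightarrow> real) \<Rightarrow> (real^'d \<Rightarrow> real) \<Rightarrow> (real \<Rightarrow> real^'d \<Rightarrow> real^'d) \<Rightarrow> ennreal" where
  "cfm_objective \<phi> p0 p1 v =
     (\<integral>\<^sup>+ (t, x0, x1). ennreal ((norm (v t (\<phi> t x1 x0) - time_deriv \<phi> t x1 x0))\<^sup>2) \<partial>sample_law p0 p1)"

definition optimal_velocity ::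
  "(real \<Rightarrow> real^'d \<Rightarrow> real^'d \<Rightarrow> real^'d) \<Rightarrow> (real^'d \<Rightarrow> real) \<Rightarrow> (real^'d \<Rightarrow> real) \<Rightarrow> (real \<Rightarrow> real^'d \<Rightarrow> real^'d) \<Rightarrow> bool" where
  "optimal_velocity \<phi> p0 p1 v \<longleftrightarrow> is_arg_min (cfm_objective \<phi> p0 p1) vector_field v"

end

theory Submission
  imports Defs "HOL-Probability.Probability_Measure"
begin

text \<open>For fixed \<open>t\<close> and \<open>x1\<close>, substituting \<open>x = \<phi> t x1 x0\<close> turns the objective into the integral over
  \<open>(t, x)\<close> of the weighted least squares functional
  \<open>\<integral> (norm (v t x - w))\<^sup>2 * p0 (inv (\<phi> t x1) x) * \<bar>J\<bar> * p1 x1 dx1\<close>, where \<open>w\<close> is the conditional velocity at \<open>x\<close>.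
  It is minimized pointwise by the weighted mean of \<open>w\<close>, which is \<open>v_star t x\<close>, and the excess of
  any other \<open>v\<close> is the weighted squared distance to \<open>v_star\<close>. Since the inequality with this excess
  holds whenever the total weight is finite, hence for almost all \<open>x\<close>, no integrability of \<open>w\<close> is
  needed, and a second minimizer of finite objective has excess zero.\<close>

section \<open>Measurability of derivatives and Jacobian determinants\<close>

text \<open>Measurability passes to limits of sequences, so the derivative is presented as the limit
  of difference quotients along the steps \<open>1 / real (Suc n)\<close>, which are positive and
  tend to zero.\<close>

lemma has_vector_derivative_sequentially:
  fixes f :: "real \<Rightarrow> 'a::real_normed_vector"
  assumes "(f has_vector_derivative d) (at a)"
  shows "(\<lambda>n. real (Suc n) *\<^sub>R (f (a + 1 / real (Suc n)) - f a)) \<longlonglongrightarrow> d"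
proof -
  let ?y = "\<lambda>n. a + 1 / real (Suc n)"
  have "filterlim ?y (at a) sequentially"
    using tendsto_add[OF tendsto_const[of a] LIMSEQ_Suc[OF lim_1_over_n]]
    by (simp add: filterlim_at)
  moreover have "((\<lambda>y. norm (f y - f a - (y - a) *\<^sub>R d) / norm (y - a)) \<longlongrightarrow> 0) (at a)"
    using assms unfolding has_vector_derivative_def has_derivative_iff_norm by simp
  ultimately have "(\<lambda>n. norm (f (?y n) - f a - (?y n - a) *\<^sub>R d) / norm (?y n - a)) \<longlonglongrightarrow> 0"
    by (rule filterlim_compose[rotated])
  also have "(\<lambda>n. norm (f (?y n) - f a - (?y n - a) *\<^sub>R d) / norm (?y n - a)) =
    (\<lambda>n. norm (real (Suc n) *\<^sub>R (f (?y n) - f a) - d))"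
  proof
    fix n
    define k where "k = real (Suc n)"
    have "0 < k" by (simp add: k_def)
    then have "k *\<^sub>R (f (a + 1 / k) - f a) - d = k *\<^sub>R (f (a + 1 / k) - f a - (1 / k) *\<^sub>R d)"
      by (simp add: scaleR_diff_right)
    with \<open>0 < k\<close> show "norm (f (?y n) - f a - (?y n - a) *\<^sub>R d) / norm (?y n - a) =
      norm (real (Suc n) *\<^sub>R (f (?y n) - f a) - d)"
      unfolding k_def[symmetric] by simp
  qed
  finally show ?thesis
    by (simp only: tendsto_norm_zero_iff Lim_null[symmetric])
qed

text \<open>By the chain rule, \<open>s \<mapsto> f (x + s *\<^sub>R h)\<close> has vector
  derivative \<open>frechet_derivative f (at x) h\<close> at zero, which reduces the claim to one
  real variable.\<close>

lemma frechet_derivative_sequentially: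
  fixes f :: "'a::real_normed_vector \<Rightarrow> 'b::real_normed_vector"
  assumes "f differentiable (at x)"
  shows "(\<lambda>n. real (Suc n) *\<^sub>R (f (x + (1 / real (Suc n)) *\<^sub>R h) - f x)) \<longlonglongrightarrow>
    frechet_derivative f (at x) h"
proof -
  let ?D = "frechet_derivative f (at x)"
  have D: "(f has_derivative ?D) (at x)"
    using assms frechet_derivative_works by blast
  have "((\<lambda>s. f (x + s *\<^sub>R h)) has_derivative (\<lambda>s. ?D (s *\<^sub>R h))) (at 0)"
    by (rule has_derivative_compose[of "\<lambda>s. x + s *\<^sub>R h" "\<lambda>s. s *\<^sub>R h" 0 UNIV f ?D])
      (auto intro!: derivative_eq_intros D)
  then have "((\<lambda>s. f (x + s *\<^sub>R h)) has_vector_derivative ?D h) (at 0)"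
    unfolding has_vector_derivative_def
    by (simp add: linear_simps(5)[OF has_derivative_bounded_linear[OF D]])
  from has_vector_derivative_sequentially[OF this] show ?thesis by simp
qed

text \<open>Directional derivatives are pointwise limits of difference quotients, each jointly
  measurable in the parameter and the point.\<close>

lemma borel_measurable_frechet_derivative:
  fixes f :: "'a \<Rightarrow> 'b::euclidean_space \<Rightarrow> 'c::euclidean_space"
  assumes f: "(\<lambda>(a, x). f a x) \<in> borel_measurable (M \<Otimes>\<^sub>M borel)"
    and diff: "\<And>a x. a \<in> space M \<Longrightarrow> f a differentiable (at x)"
  shows "(\<lambda>(a, x). frechet_derivative (f a) (at x) h) \<in> borel_measurable (M \<Otimes>\<^sub>M borel)"
proof (rule borel_measurable_LIMSEQ_metric)
  fix n
  have "(\<lambda>z. f (fst z) (snd z + (1 / real (Suc n)) *\<^sub>R h)) \<in> borel_measurable (M \<Otimes>\<^sub>M borel)"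
    using measurable_compose[OF _ f, of "\<lambda>z. (fst z, snd z + (1 / real (Suc n)) *\<^sub>R h)"] by simp
  with f show "(\<lambda>(a, x). real (Suc n) *\<^sub>R (f a (x + (1 / real (Suc n)) *\<^sub>R h) - f a x))
    \<in> borel_measurable (M \<Otimes>\<^sub>M borel)"
    unfolding split_beta by measurable
next
  fix z :: "'a \<times> 'b" assume "z \<in> space (M \<Otimes>\<^sub>M borel)"
  then show "(\<lambda>n. (\<lambda>(a, x). real (Suc n) *\<^sub>R (f a (x + (1 / real (Suc n)) *\<^sub>R h) - f a x)) z)
    \<longlonglongrightarrow> (\<lambda>(a, x). frechet_derivative (f a) (at x) h) z"
    using frechet_derivative_sequentially[OF diff] by (auto simp: space_pair_measure split: prod.split)
qed

text \<open>The determinant is a polynomial in the matrix entries, and these are coordinates of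
  directional derivatives along the axes.\<close>

lemma borel_measurable_det_jacobian:
  fixes f :: "'a \<Rightarrow> real^'n \<Rightarrow> real^'n"
  assumes "(\<lambda>(a, x). f a x) \<in> borel_measurable (M \<Otimes>\<^sub>M borel)"
    and "\<And>a x. a \<in> space M \<Longrightarrow> f a differentiable (at x)"
  shows "(\<lambda>(a, x). det (jacobian (f a) (at x))) \<in> borel_measurable (M \<Otimes>\<^sub>M borel)"
proof -
  have [measurable]: "(\<lambda>z. frechet_derivative (f (fst z)) (at (snd z)) h) \<in> borel_measurable (M \<Otimes>\<^sub>M borel)" for h
    using borel_measurable_frechet_derivative[OF assms] by (simp add: split_beta)
  have "(\<lambda>z. frechet_derivative (f (fst z)) (at (snd z)) h $ i) \<in> borel_measurable (M \<Otimes>\<^sub>M borel)" for h i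
    by (simp add: cart_eq_inner_axis)
  then show ?thesis
    unfolding det_def jacobian_def matrix_def split_beta by simp
qed

lemma borel_measurable_differentiable:
  fixes g :: "'a::real_normed_vector \<Rightarrow> 'b::real_normed_vector"
  assumes "\<And>x. g differentiable (at x)"
  shows "g \<in> borel_measurable borel"
  by (intro borel_measurable_continuous_onI continuous_at_imp_continuous_on ballI
      differentiable_imp_continuous_within assms)

lemma borel_measurable_det_jacobian':
  fixes g :: "real^'n \<Rightarrow> real^'n"
  assumes diff: "\<And>x. g differentiable (at x)"
  shows "(\<lambda>x. det (jacobian g (at x))) \<in> borel_measurable borel"
proof -
  \<comment> \<open>A one-point parameter space turns the single map \<open>g\<close> into a
    parametrised family.\<close>
  have "(\<lambda>(a, x). g x) \<in> borel_measurable (count_space {()} \<Otimes>\<^sub>M borel)"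
    using borel_measurable_differentiable[OF diff]
    by (auto intro: measurable_compose[OF measurable_snd] simp: split_beta)
  then have "(\<lambda>(a, x). det (jacobian g (at x))) \<in> borel_measurable (count_space {()} \<Otimes>\<^sub>M borel)"
    by (intro borel_measurable_det_jacobian diff)
  from measurable_compose[OF _ this, of "\<lambda>x. ((), x)"] show ?thesis by simp
qed

section \<open>Change of variables for differentiable bijections\<close>

text \<open>Lebesgue measure is determined by its values on boxes, and the volume of a box is the
  integral of the absolute Jacobian determinant over its preimage. As an identity of measures, this
  yields the substitution rule for all nonnegative integrands at once.\<close>

lemma distr_density_abs_det_jacobian:
  fixes g :: "real^'n::{finite,wellorder} \<Rightarrow> real^'n::_"
  assumes "bij g" and diff: "\<And>x. g differentiable (at x)"
  shows "distr (density lborel (\<lambda>x. ennreal \<bar>det (jacobian g (at x))\<bar>)) borel g = lborel"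
proof (rule lborel_eqI[symmetric])
  note [measurable] = borel_measurable_det_jacobian'[OF diff]
    borel_measurable_differentiable[OF diff]
  fix l u :: "real^'n::_"
  assume lu: "\<And>b. b \<in> Basis \<Longrightarrow> l \<bullet> b \<le> u \<bullet> b"
  define S where "S = g -` box l u"
  have S[measurable]: "S \<in> sets borel"
    unfolding S_def using measurable_sets_borel[of g borel "box l u"] by simp
  have image: "g ` S = box l u"
    unfolding S_def using \<open>bij g\<close> by (simp add: bij_is_surj surj_image_vimage_eq)
  have "g ` S \<in> lmeasurable \<and> measure lebesgue (g ` S) = (\<Prod>b\<in>Basis. (u - l) \<bullet> b)"
    unfolding image using lu by (simp add: measure_def prod_nonneg inner_simps)
  moreover have "(g has_derivative frechet_derivative g (at x)) (at x within S)" for x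
    using frechet_derivative_works[THEN iffD1, OF diff] by (rule has_derivative_at_withinI)
  moreover have "inj_on g S"
    using bij_is_inj[OF \<open>bij g\<close>] by (rule inj_on_subset) simp
  ultimately have "((\<lambda>x. \<bar>det (jacobian g (at x))\<bar>) has_integral (\<Prod>b\<in>Basis. (u - l) \<bullet> b)) S"
    unfolding jacobian_def
    using S by (intro has_measure_differentiable_image[THEN iffD1]) auto
  then have "(\<integral>\<^sup>+x. ennreal \<bar>det (jacobian g (at x))\<bar> * indicator S x \<partial>lborel) =
    ennreal (\<Prod>b\<in>Basis. (u - l) \<bullet> b)"
    by (intro nn_integral_has_integral_lebesgue') auto
  then show "emeasure (distr (density lborel (\<lambda>x. ennreal \<bar>det (jacobian g (at x))\<bar>)) borel g) (box l u) =
    (\<Prod>b\<in>Basis. (u - l) \<bullet> b)"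
    using S by (simp add: emeasure_distr emeasure_density S_def[symmetric])
qed simp

text \<open>The change of variables theorems of the library assume that the index type of the vectors
  is well-ordered; a well-ordered type with as many elements as \<open>'a\<close> lets us transfer them to any
  finite index type.\<close>

typedef (overloaded) 'a ordered_index = "{..<CARD('a::finite)}"
  by (intro exI[of _ 0]) simp

instance ordered_index :: (finite) finite
proof
  have "(UNIV :: 'a ordered_index set) = Abs_ordered_index ` {..<CARD('a)}"
    by (rule type_definition.Abs_image[OF type_definition_ordered_index, symmetric])
  then show "finite (UNIV :: 'a ordered_index set)" by (metis finite_imageI finite_lessThan)
qed

instantiation ordered_index :: (finite) wellorder
begin

definition less_eq_ordered_index :: "'a ordered_index \<Rightarrow> 'a ordered_index \<Rightarrow> bool" where
  "less_eq_ordered_index i j \<longleftrightarrow> Rep_ordered_index i \<le> Rep_ordered_index j"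

definition less_ordered_index :: "'a ordered_index \<Rightarrow> 'a ordered_index \<Rightarrow> bool" where
  "less_ordered_index i j \<longleftrightarrow> Rep_ordered_index i < Rep_ordered_index j"

instance
proof
  fix P :: "'a ordered_index \<Rightarrow> bool" and a :: "'a ordered_index"
  assume step: "\<And>i. (\<And>j. j < i \<Longrightarrow> P j) \<Longrightarrow> P i"
  show "P a"
    by (induction a rule: measure_induct_rule[of Rep_ordered_index])
      (rule step, simp add: less_ordered_index_def)
qed (auto simp: less_eq_ordered_index_def less_ordered_index_def Rep_ordered_index_inject)

end

lemma ex_bij_ordered_index: "\<exists>s :: 'a ordered_index \<Rightarrow> 'a::finite. bij s"
proof -
  have "bij_betw Rep_ordered_index (UNIV :: 'a ordered_index set) {..<CARD('a)}"
    using type_definition.Rep_range[OF type_definition_ordered_index]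
    by (metis Rep_ordered_index_inject bij_betw_def injI)
  then have "card (UNIV :: 'a ordered_index set) = CARD('a)"
    using bij_betw_same_card by fastforce
  then show ?thesis by (intro finite_same_card_bij) auto
qed

text \<open>Pullback of coordinates along \<open>s\<close>, hence contravariant: for bijective
  \<open>s\<close>, the inverse map is \<open>reindex (inv s)\<close>.\<close>

definition reindex :: "('m \<Rightarrow> 'n) \<Rightarrow> 'a^'n \<Rightarrow> 'a^'m" where
  "reindex s v = (\<chi> i. v $ s i)"

lemma reindex_nth [simp]: "reindex s v $ i = v $ s i"
  by (simp add: reindex_def)

lemma reindex_reindex: "reindex s (reindex r v) = reindex (r \<circ> s) v"
  by (simp add: vec_eq_iff)

lemma reindex_id [simp]: "reindex id v = v"
  by (simp add: vec_eq_iff)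

lemma bounded_linear_reindex: "bounded_linear (reindex s :: real^'n \<Rightarrow> real^'m)"
  by (intro linear_conv_bounded_linear[THEN iffD1] linearI) (simp_all add: vec_eq_iff)

lemma borel_measurable_reindex [measurable]:
  "(reindex s :: real^'n \<Rightarrow> real^'m) \<in> borel_measurable borel"
  by (intro borel_measurable_continuous_onI linear_continuous_on bounded_linear_reindex)

lemma reindex_axis:
  assumes "bij s"
  shows "reindex s (axis (s j) c) = axis j c"
  using assms by (auto simp: vec_eq_iff axis_def bij_def inj_eq)

text \<open>The preimage of a box under a relabelling of coordinates is a box with the same side
  lengths in another order.\<close>

lemma distr_lborel_reindex:
  fixes s :: "'m::finite \<Rightarrow> 'n::finite"
  assumes "bij s"
  shows "distr lborel borel (reindex s :: real^'n \<Rightarrow> real^'m) = lborel"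
proof (rule lborel_eqI[symmetric])
  \<comment> \<open>Basis vectors correspond to indices, so box volumes become products over
    indices, which a bijection can permute.\<close>
  have prod: "(\<Prod>b\<in>Basis. x \<bullet> b) = (\<Prod>i\<in>UNIV. x $ i)" for x :: "real^'k"
    by (simp add: Basis_vec_def prod.UNION_disjoint axis_eq_axis inner_axis)
  fix l u :: "real^'m"
  assume "\<And>b. b \<in> Basis \<Longrightarrow> l \<bullet> b \<le> u \<bullet> b"
  then have le: "l $ i \<le> u $ i" for i
    by (force simp: Basis_vec_def inner_axis)
  let ?l = "reindex (inv s) l" and ?u = "reindex (inv s) u"
  have vimage: "reindex s -` box l u = box ?l ?u"
  proof (rule set_eqI)
    fix x
    have "(\<forall>i. l $ i < x $ s i \<and> x $ s i < u $ i) \<longleftrightarrow> (\<forall>j. l $ inv s j < x $ j \<and> x $ j < u $ inv s j)"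
      by (metis assms bij_inv_eq_iff)
    then show "x \<in> reindex s -` box l u \<longleftrightarrow> x \<in> box ?l ?u"
      by (simp add: mem_box_cart)
  qed
  have "emeasure (distr lborel borel (reindex s)) (box l u) = emeasure lborel (box ?l ?u)"
    by (subst emeasure_distr) (auto simp: vimage)
  also have "\<dots> = ennreal (\<Prod>b\<in>Basis. (?u - ?l) \<bullet> b)"
    using le by (intro emeasure_lborel_box) (auto simp: Basis_vec_def inner_axis)
  also have "(\<Prod>b\<in>Basis. (?u - ?l) \<bullet> b) = (\<Prod>i\<in>UNIV. (u - l) $ inv s i)"
    unfolding prod by simp
  also have "\<dots> = (\<Prod>b\<in>Basis. (u - l) \<bullet> b)"
    unfolding prod using bij_imp_bij_inv[OF assms] by (rule prod.reindex_bij_betw)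
  finally show "emeasure (distr lborel borel (reindex s)) (box l u) = (\<Prod>b\<in>Basis. (u - l) \<bullet> b)" .
qed simp

text \<open>In the Leibniz formula, \<open>map_permutation UNIV s\<close> is conjugation of
  permutations by \<open>s\<close>; it is a bijection between the permutations of the two index
  types and preserves signs.\<close>

lemma det_reindex:
  fixes A :: "'a::comm_ring_1^'n^'n" and s :: "'m::finite \<Rightarrow> 'n::finite"
  assumes "bij s"
  shows "det (\<chi> i j. A $ s i $ s j) = det A"
proof -
  let ?c = "map_permutation UNIV s"
  have c: "?c p (s i) = s (p i)" for p i
    using assms by (simp add: map_permutation_apply bij_is_inj)
  have "inj_on s UNIV" using assms by (simp add: bij_is_inj)
  then have sgn: "sign (?c p) = sign p" if "p permutes UNIV" for p
    using that by (simp add: sign_map_permutation)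
  have bij_c: "bij_betw ?c {p. p permutes UNIV} {p. p permutes UNIV}"
  proof (rule bij_betw_byWitness[where f' = "map_permutation UNIV (inv s)"])
    show "\<forall>p\<in>{p. p permutes UNIV}. map_permutation UNIV (inv s) (?c p) = p"
      using assms by (auto intro!: map_permutation_compose_inv simp: bij_is_inj)
    show "\<forall>p\<in>{p. p permutes UNIV}. ?c (map_permutation UNIV (inv s) p) = p"
      using bij_imp_bij_inv[OF assms] assms
      by (auto intro!: map_permutation_compose_inv simp: bij_is_surj surj_f_inv_f)
    show "?c ` {p. p permutes UNIV} \<subseteq> {p. p permutes UNIV}"
      using map_permutation_permutes[OF assms] by auto
    show "map_permutation UNIV (inv s) ` {p. p permutes UNIV} \<subseteq> {p. p permutes UNIV}"
      using map_permutation_permutes[OF bij_imp_bij_inv[OF assms]] by auto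
  qed
  from sum.reindex_bij_betw[OF bij_c, symmetric]
  have "det A = (\<Sum>p | p permutes (UNIV::'m set). of_int (sign (?c p)) * (\<Prod>i\<in>UNIV. A $ i $ ?c p i))"
    unfolding det_def by simp
  also have "\<dots> = (\<Sum>p | p permutes (UNIV::'m set). of_int (sign p) * (\<Prod>i\<in>UNIV. A $ s i $ s (p i)))"
    by (intro sum.cong refl) (simp add: sgn c prod.reindex_bij_betw[OF assms, symmetric])
  finally show ?thesis by (simp add: det_def)
qed

text \<open>Relabelling the coordinates conjugates \<open>g\<close> to a map \<open>h\<close> over a
  well-ordered index type. Relabelling preserves both Lebesgue measure and Jacobian determinants, so
  the substitution rule for \<open>h\<close> transfers back to \<open>g\<close>.\<close>

lemma nn_integral_change_of_variables_bij:
  fixes g :: "real^'n \<Rightarrow> real^'n"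
  assumes "bij g" and diff: "\<And>x. g differentiable (at x)"
    and [measurable]: "f \<in> borel_measurable borel"
  shows "(\<integral>\<^sup>+x. f x \<partial>lborel) = (\<integral>\<^sup>+x. ennreal \<bar>det (jacobian g (at x))\<bar> * f (g x) \<partial>lborel)"
proof -
  note [measurable] = borel_measurable_det_jacobian'[OF diff]
    borel_measurable_differentiable[OF diff]
  obtain s :: "'n ordered_index \<Rightarrow> 'n" where s: "bij s" using ex_bij_ordered_index by blast
  define R :: "real^'n \<Rightarrow> real^'n ordered_index" where "R = reindex s"
  define Q :: "real^'n ordered_index \<Rightarrow> real^'n" where "Q = reindex (inv s)"
  have [measurable]: "R \<in> borel_measurable borel" "Q \<in> borel_measurable borel"
    and blR: "bounded_linear R" and blQ: "bounded_linear Q"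
    by (simp_all add: R_def Q_def bounded_linear_reindex)
  have RQ [simp]: "R (Q v) = v" and QR [simp]: "Q (R w) = w" for v w
    using s by (simp_all add: R_def Q_def reindex_reindex bij_is_inj surj_iff[THEN iffD1] bij_is_surj)
  define h where "h = (\<lambda>y. R (g (Q y)))"
  let ?D = "\<lambda>x. frechet_derivative g (at x)"
  have "(g has_derivative ?D x) (at x)" for x
    using diff frechet_derivative_works by blast
  then have "((\<lambda>y. R (g (Q y))) has_derivative (\<lambda>v. R (?D (Q y) (Q v)))) (at y)" for y
    by (intro bounded_linear.has_derivative[OF blR]
        has_derivative_compose[OF bounded_linear_imp_has_derivative[OF blQ]])
  then have h: "(h has_derivative (\<lambda>v. R (?D (Q y) (Q v)))) (at y)" for y
    by (simp add: h_def)
  have Q_axis: "Q (axis j c) = axis (s j) c" for j c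
    using reindex_axis[OF bij_imp_bij_inv[OF s], of "s j" c] s by (simp add: Q_def bij_is_inj)
  \<comment> \<open>Relabelling permutes the rows and columns of the Jacobian simultaneously, which
    is the situation of \<open>det_reindex\<close>.\<close>
  have "jacobian h (at y) = (\<chi> i j. jacobian g (at (Q y)) $ s i $ s j)" for y
    unfolding jacobian_def frechet_derivative_at[OF h, symmetric]
    by (simp add: matrix_def Q_axis) (simp add: R_def)
  then have det: "det (jacobian h (at y)) = det (jacobian g (at (Q y)))" for y
    by (simp add: det_reindex[OF s])
  have "bij h"
    unfolding h_def using \<open>bij g\<close>
    by (intro bij_betw_byWitness[where f' = "\<lambda>y. R (inv g (Q y))"])
      (simp_all add: bij_is_inj bij_is_surj surj_f_inv_f)
  have hdiff: "h differentiable (at y)" for y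
    using h differentiable_def by blast
  note [measurable] = borel_measurable_det_jacobian'[OF hdiff]
    borel_measurable_differentiable[OF hdiff]
  have Q: "integral\<^sup>N lborel F = (\<integral>\<^sup>+y. F (Q y) \<partial>lborel)"
    if "F \<in> borel_measurable borel" for F :: "real^'n \<Rightarrow> ennreal"
    using that by (subst distr_lborel_reindex[OF bij_imp_bij_inv[OF s], symmetric])
      (simp add: nn_integral_distr Q_def)
  have "integral\<^sup>N lborel f = (\<integral>\<^sup>+y. f (Q y) \<partial>lborel)" by (simp add: Q)
  also have "\<dots> = (\<integral>\<^sup>+y. ennreal \<bar>det (jacobian h (at y))\<bar> * f (Q (h y)) \<partial>lborel)"
    \<comment> \<open>The outer \<open>lborel\<close> is replaced by the pushforward under
      \<open>h\<close> of the measure with density the absolute Jacobian determinant.\<close>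
    by (subst distr_density_abs_det_jacobian[OF \<open>bij h\<close> hdiff, symmetric])
      (simp add: nn_integral_distr nn_integral_density)
  also have "\<dots> = (\<integral>\<^sup>+y. ennreal \<bar>det (jacobian g (at (Q y)))\<bar> * f (g (Q y)) \<partial>lborel)"
    by (simp add: det) (simp add: h_def)
  also have "\<dots> = (\<integral>\<^sup>+x. ennreal \<bar>det (jacobian g (at x))\<bar> * f (g x) \<partial>lborel)"
    by (rule Q[symmetric]) simp
  finally show ?thesis .
qed

section \<open>Weighted least squares\<close>

text \<open>Expanding the square of \<open>a - w x = (a - m) + (m - w x)\<close> leaves a cross term
  whose weighted integral vanishes, as \<open>m\<close> is the weighted mean. If the right-hand side
  is infinite there is nothing to show; if it is finite, it forces the integrability of
  \<open>\<rho> x *\<^sub>R w x\<close> that the argument requires.\<close>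

lemma conditional_mean_minimizes:
  fixes w :: "'a \<Rightarrow> 'b::euclidean_space" and \<rho> :: "'a \<Rightarrow> real"
  assumes [measurable]: "w \<in> borel_measurable M" "\<rho> \<in> borel_measurable M"
    and nonneg: "\<And>x. 0 \<le> \<rho> x"
    and fin: "(\<integral>\<^sup>+x. \<rho> x \<partial>M) < \<infinity>"
  defines "m \<equiv> (\<integral>x. \<rho> x *\<^sub>R w x \<partial>M) /\<^sub>R (\<integral>x. \<rho> x \<partial>M)"
  shows "(\<integral>\<^sup>+x. ennreal ((norm (m - w x))\<^sup>2 * \<rho> x) \<partial>M) + (\<integral>\<^sup>+x. ennreal ((norm (a - m))\<^sup>2 * \<rho> x) \<partial>M)
    \<le> (\<integral>\<^sup>+x. ennreal ((norm (a - w x))\<^sup>2 * \<rho> x) \<partial>M)"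
proof (cases "(\<integral>\<^sup>+x. ennreal ((norm (a - w x))\<^sup>2 * \<rho> x) \<partial>M) < \<infinity>")
  case False
  then show ?thesis by (simp add: not_less top.extremum_unique)
next
  case True
  have \<rho>: "integrable M \<rho>"
    using fin nonneg by (intro integrableI_nonneg) auto
  have aw: "integrable M (\<lambda>x. (norm (a - w x))\<^sup>2 * \<rho> x)"
    using True nonneg by (intro integrableI_nonneg) auto
  \<comment> \<open>From \<open>(r - 1/2)\<^sup>2 \<ge> 0\<close> with
    \<open>r = norm (a - w x)\<close>. Finite mass and finite second moment thereby control the
    first moment.\<close>
  have bound: "norm (a - w x) \<le> 1 + (norm (a - w x))\<^sup>2" for x
    using zero_le_power2[of "norm (a - w x) - 1 / 2"] by (simp add: power2_diff power_divide)
  have awl: "integrable M (\<lambda>x. \<rho> x *\<^sub>R (a - w x))"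
  proof (rule Bochner_Integration.integrable_bound[OF Bochner_Integration.integrable_add[OF \<rho> aw]])
    show "AE x in M. norm (\<rho> x *\<^sub>R (a - w x)) \<le> norm (\<rho> x + (norm (a - w x))\<^sup>2 * \<rho> x)"
      using mult_left_mono[OF bound nonneg] nonneg
      by (simp add: distrib_left mult.commute del: scaleR_diff_right)
  qed simp
  have "integrable M (\<lambda>x. \<rho> x *\<^sub>R a - \<rho> x *\<^sub>R (a - w x))"
    using \<rho> awl by (intro Bochner_Integration.integrable_diff) auto
  then have w: "integrable M (\<lambda>x. \<rho> x *\<^sub>R w x)"
    by (simp add: scaleR_diff_right)
  show ?thesis
  proof (cases "(\<integral>x. \<rho> x \<partial>M) = 0")
    \<comment> \<open>With zero total weight, \<open>m\<close> is only the default value of a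
      division by zero, but then all three integrals vanish.\<close>
    case True
    then have "AE x in M. \<rho> x = 0"
      using integral_nonneg_eq_0_iff_AE[OF \<rho>] nonneg by simp
    then have "(\<integral>\<^sup>+x. ennreal ((norm (b x))\<^sup>2 * \<rho> x) \<partial>M) = (\<integral>\<^sup>+x. 0 \<partial>M)" for b :: "'a \<Rightarrow> 'b"
      by (intro nn_integral_cong_AE) (auto elim!: eventually_mono)
    then show ?thesis by simp
  next
    case False
    let ?i = "\<lambda>x. 2 * ((a - m) \<bullet> (\<rho> x *\<^sub>R (m - w x)))"
    have mw: "integrable M (\<lambda>x. \<rho> x *\<^sub>R (m - w x))"
      using \<rho> w by (simp add: scaleR_diff_right)
    have am: "integrable M (\<lambda>x. (norm (a - m))\<^sup>2 * \<rho> x)"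
      using \<rho> by simp
    have cross: "integrable M ?i"
      by (intro integrable_mult_right Bochner_Integration.integrable_inner_right mw)
    have expand: "(norm (m - w x))\<^sup>2 * \<rho> x = (norm (a - w x))\<^sup>2 * \<rho> x - (norm (a - m))\<^sup>2 * \<rho> x - ?i x" for x
      by (simp add: power2_norm_eq_inner inner_simps inner_commute algebra_simps)
    have int: "integrable M (\<lambda>x. (norm (m - w x))\<^sup>2 * \<rho> x)"
      unfolding expand by (intro Bochner_Integration.integrable_diff aw am cross)
    \<comment> \<open>The deviations from the mean cancel; nonzero total weight is what makes the
      division in \<open>m\<close> genuine.\<close>
    have "(\<integral>x. \<rho> x *\<^sub>R (m - w x) \<partial>M) = (\<integral>x. \<rho> x \<partial>M) *\<^sub>R m - (\<integral>x. \<rho> x *\<^sub>R w x \<partial>M)"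
      using \<rho> w by (simp add: scaleR_diff_right)
    also have "\<dots> = 0"
      using False by (simp add: m_def)
    finally have "(\<integral>x. ?i x \<partial>M) = 0"
      by (simp only: integral_mult_right_zero Bochner_Integration.integral_inner_right[OF mw] inner_zero_right mult_zero_right)
    then have "(\<integral>x. (norm (m - w x))\<^sup>2 * \<rho> x \<partial>M) =
        (\<integral>x. (norm (a - w x))\<^sup>2 * \<rho> x \<partial>M) - (\<integral>x. (norm (a - m))\<^sup>2 * \<rho> x \<partial>M)"
      unfolding expand
      by (simp only: Bochner_Integration.integral_diff[OF Bochner_Integration.integrable_diff[OF aw am] cross]
          Bochner_Integration.integral_diff[OF aw am] diff_zero)
    moreover have "0 \<le> (\<integral>x. (norm (m - w x))\<^sup>2 * \<rho> x \<partial>M)" "0 \<le> (\<integral>x. (norm (a - m))\<^sup>2 * \<rho> x \<partial>M)"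
      using nonneg by (auto intro!: integral_nonneg)
    \<comment> \<open>All three integrands are integrable and nonnegative, so the identity of real
      integrals carries over to \<open>ennreal\<close>.\<close>
    moreover have eq: "(\<integral>\<^sup>+x. ennreal (f x) \<partial>M) = ennreal (\<integral>x. f x \<partial>M)"
      if "integrable M f" "\<And>x. 0 \<le> f x" for f :: "'a \<Rightarrow> real"
      using that by (intro nn_integral_eq_integral) auto
    ultimately show ?thesis
      using nonneg unfolding eq[OF aw mult_nonneg_nonneg[OF zero_le_power2 nonneg]]
        eq[OF am mult_nonneg_nonneg[OF zero_le_power2 nonneg]] eq[OF int mult_nonneg_nonneg[OF zero_le_power2 nonneg]]
      by (simp only: ennreal_plus[symmetric]) simp
  qed
qed

section \<open>The flow matching objective for an abstract measurable flow\<close>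

text \<open>\<open>W\<close> enters the least squares argument only as a measurable function, so it
  is a parameter of its own. The maps are well behaved on all of \<open>space T\<close>; exceptional
  times are dealt with when the locale is interpreted.\<close>

locale conditional_flow = T: sigma_finite_measure T for T :: "'t measure" +
  fixes \<Phi> \<Psi> W :: "'t \<Rightarrow> real^'d \<Rightarrow> real^'d \<Rightarrow> real^'d" and p0 p1 :: "real^'d \<Rightarrow> real"
  assumes \<Phi>_triple: "(\<lambda>(t, x1, x0). \<Phi> t x1 x0) \<in> borel_measurable (T \<Otimes>\<^sub>M borel \<Otimes>\<^sub>M borel)"
    and \<Psi>_triple: "(\<lambda>(t, x1, x). \<Psi> t x1 x) \<in> borel_measurable (T \<Otimes>\<^sub>M borel \<Otimes>\<^sub>M borel)"
    and W_triple: "(\<lambda>(t, x1, x0). W t x1 x0) \<in> borel_measurable (T \<Otimes>\<^sub>M borel \<Otimes>\<^sub>M borel)"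
    and \<Psi>_\<Phi>: "\<And>t x1 x. t \<in> space T \<Longrightarrow> \<Psi> t x1 (\<Phi> t x1 x) = x"
    and \<Phi>_\<Psi>: "\<And>t x1 x. t \<in> space T \<Longrightarrow> \<Phi> t x1 (\<Psi> t x1 x) = x"
    and \<Psi>_differentiable: "\<And>t x1 x. t \<in> space T \<Longrightarrow> \<Psi> t x1 differentiable (at x)"
    and p0_density: "prob_density p0" and p1_density: "prob_density p1"
begin

definition law :: "('t \<times> (real^'d) \<times> (real^'d)) measure" where
  "law = T \<Otimes>\<^sub>M (density lborel p0 \<Otimes>\<^sub>M density lborel p1)"

definition jac :: "'t \<Rightarrow> real^'d \<Rightarrow> real^'d \<Rightarrow> real" where
  "jac t x1 x = \<bar>det (jacobian (\<Psi> t x1) (at x))\<bar>"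

text \<open>The joint density of \<open>x1\<close> and the position \<open>x\<close> at time \<open>t\<close>.\<close>

definition joint :: "'t \<Rightarrow> real^'d \<Rightarrow> real^'d \<Rightarrow> real" where
  "joint t x x1 = p0 (\<Psi> t x1 x) * jac t x1 x * p1 x1"

text \<open>The conditional expectation of the velocity given the position \<open>x\<close> at time
  \<open>t\<close>; it is zero where the total density is zero.\<close>

definition mean_velocity :: "'t \<Rightarrow> real^'d \<Rightarrow> real^'d" where
  "mean_velocity t x =
    (\<integral>x1. joint t x x1 *\<^sub>R W t x1 (\<Psi> t x1 x) \<partial>lborel) /\<^sub>R (\<integral>x1. joint t x x1 \<partial>lborel)"

definition objective :: "('t \<Rightarrow> real^'d \<Rightarrow> real^'d) \<Rightarrow> ennreal" where
  "objective v = (\<integral>\<^sup>+(t, x0, x1). ennreal ((norm (v t (\<Phi> t x1 x0) - W t x1 x0))\<^sup>2) \<partial>law)"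

lemma p0_measurable [measurable]: "p0 \<in> borel_measurable borel"
  and p0_nonneg [simp]: "0 \<le> p0 x"
  and p0_total: "(\<integral>\<^sup>+x. ennreal (p0 x) \<partial>lborel) = 1"
  and p1_measurable [measurable]: "p1 \<in> borel_measurable borel"
  and p1_nonneg [simp]: "0 \<le> p1 x"
  and p1_total: "(\<integral>\<^sup>+x. ennreal (p1 x) \<partial>lborel) = 1"
  using p0_density p1_density by (auto simp: prob_density_def)

sublocale P0: prob_space "density lborel p0"
  by standard (simp add: emeasure_density p0_total)
sublocale P1: prob_space "density lborel p1"
  by standard (simp add: emeasure_density p1_total)
sublocale P: pair_prob_space "density lborel p0" "density lborel p1" ..

text \<open>Stated for composed arguments, so that the measurability prover can apply the rules
  inside larger terms.\<close>

lemma
  assumes [measurable]: "f \<in> measurable N T" "g \<in> borel_measurable N" "h \<in> borel_measurable N"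
  shows \<Phi>_measurable [measurable (raw)]: "(\<lambda>y. \<Phi> (f y) (g y) (h y)) \<in> borel_measurable N"
    and \<Psi>_measurable [measurable (raw)]: "(\<lambda>y. \<Psi> (f y) (g y) (h y)) \<in> borel_measurable N"
    and W_measurable [measurable (raw)]: "(\<lambda>y. W (f y) (g y) (h y)) \<in> borel_measurable N"
    and jac_measurable [measurable (raw)]: "(\<lambda>y. jac (f y) (g y) (h y)) \<in> borel_measurable N"
proof -
  have "(\<lambda>y. (f y, g y, h y)) \<in> measurable N (T \<Otimes>\<^sub>M borel \<Otimes>\<^sub>M borel)" by measurable
  from measurable_compose[OF this \<Phi>_triple] measurable_compose[OF this \<Psi>_triple]
    measurable_compose[OF this W_triple]
  show "(\<lambda>y. \<Phi> (f y) (g y) (h y)) \<in> borel_measurable N"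
    "(\<lambda>y. \<Psi> (f y) (g y) (h y)) \<in> borel_measurable N"
    "(\<lambda>y. W (f y) (g y) (h y)) \<in> borel_measurable N"
    by simp_all
  \<comment> \<open>The pair of \<open>t\<close> and \<open>x1\<close> serves as a single parameter;
    the Jacobian is taken in the remaining argument.\<close>
  let ?f = "\<lambda>a. \<Psi> (fst a) (snd a)"
  have "(\<lambda>z. (fst (fst z), snd (fst z), snd z)) \<in>
      measurable ((T \<Otimes>\<^sub>M borel) \<Otimes>\<^sub>M borel) (T \<Otimes>\<^sub>M (borel \<Otimes>\<^sub>M borel))"
    by measurable
  from measurable_compose[OF this \<Psi>_triple]
  have "(\<lambda>(a, x). ?f a x) \<in> borel_measurable ((T \<Otimes>\<^sub>M borel) \<Otimes>\<^sub>M borel)"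
    by (simp add: split_beta)
  then have "(\<lambda>(a, x). det (jacobian (?f a) (at x))) \<in> borel_measurable ((T \<Otimes>\<^sub>M borel) \<Otimes>\<^sub>M borel)"
    by (rule borel_measurable_det_jacobian) (auto simp: space_pair_measure intro: \<Psi>_differentiable)
  from measurable_compose[OF _ this, of "\<lambda>y. ((f y, g y), h y)" N]
  show "(\<lambda>y. jac (f y) (g y) (h y)) \<in> borel_measurable N"
    by (simp add: jac_def)
qed

lemma joint_measurable [measurable (raw)]:
  assumes [measurable]: "f \<in> measurable N T" "g \<in> borel_measurable N" "h \<in> borel_measurable N"
  shows "(\<lambda>y. joint (f y) (g y) (h y)) \<in> borel_measurable N"
  unfolding joint_def by measurable

lemma jac_nonneg [simp]: "0 \<le> jac t x1 x"
  by (simp add: jac_def)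

lemma joint_nonneg [simp]: "0 \<le> joint t x x1"
  by (simp add: joint_def)

lemma mean_velocity_measurable [measurable (raw)]:
  assumes [measurable]: "f \<in> measurable N T" "g \<in> borel_measurable N"
  shows "(\<lambda>y. mean_velocity (f y) (g y)) \<in> borel_measurable N"
  unfolding mean_velocity_def by measurable

text \<open>For each \<open>x1\<close>, the substitution \<open>x0 = \<Psi> t x1 x\<close>
  contributes the factor \<open>jac t x1 x\<close>, which together with the two densities forms
  \<open>joint t x x1\<close>.\<close>

lemma nn_integral_fixed_time:
  assumes t: "t \<in> space T" and F [measurable]: "case_prod F \<in> borel_measurable (borel \<Otimes>\<^sub>M borel)"
  shows "(\<integral>\<^sup>+z. F (snd z) (\<Phi> t (snd z) (fst z)) \<partial>(density lborel p0 \<Otimes>\<^sub>M density lborel p1)) =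
    (\<integral>\<^sup>+x. \<integral>\<^sup>+x1. F x1 x * ennreal (joint t x x1) \<partial>lborel \<partial>lborel)"
proof -
  note [measurable] = measurable_const[OF t]
  have bij: "bij (\<Psi> t x1)" for x1
    using \<Psi>_\<Phi>[OF t] \<Phi>_\<Psi>[OF t] by (intro bij_betw_byWitness[where f' = "\<Phi> t x1"]) auto
  have "(\<integral>\<^sup>+z. F (snd z) (\<Phi> t (snd z) (fst z)) \<partial>(density lborel p0 \<Otimes>\<^sub>M density lborel p1)) =
    (\<integral>\<^sup>+x1. \<integral>\<^sup>+x0. F x1 (\<Phi> t x1 x0) \<partial>density lborel p0 \<partial>density lborel p1)"
    by (subst P.nn_integral_snd[symmetric]) auto
  also have "\<dots> = (\<integral>\<^sup>+x1. ennreal (p1 x1) * (\<integral>\<^sup>+x0. ennreal (p0 x0) * F x1 (\<Phi> t x1 x0) \<partial>lborel) \<partial>lborel)"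
    by (simp add: nn_integral_density)
  also have "\<dots> = (\<integral>\<^sup>+x1. \<integral>\<^sup>+x. F x1 x * ennreal (joint t x x1) \<partial>lborel \<partial>lborel)"
  proof (intro nn_integral_cong)
    fix x1
    have Fx [measurable]: "F x1 \<in> borel_measurable borel"
      using measurable_compose_Pair1[OF _ F] by simp
    have [measurable]: "\<Phi> t x1 \<in> borel_measurable borel" "\<Psi> t x1 \<in> borel_measurable borel"
      "jac t x1 \<in> borel_measurable borel"
      by measurable
    have "(\<integral>\<^sup>+x0. ennreal (p0 x0) * F x1 (\<Phi> t x1 x0) \<partial>lborel) =
      (\<integral>\<^sup>+x. ennreal (jac t x1 x) * (ennreal (p0 (\<Psi> t x1 x)) * F x1 x) \<partial>lborel)"
    proof (subst nn_integral_change_of_variables_bij[OF bij[of x1] \<Psi>_differentiable[OF t]])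
      show "(\<lambda>x0. ennreal (p0 x0) * F x1 (\<Phi> t x1 x0)) \<in> borel_measurable borel"
        by (intro borel_measurable_times_ennreal measurable_compose[OF _ Fx]) measurable
    qed (simp add: \<Phi>_\<Psi>[OF t] jac_def)
    then have "ennreal (p1 x1) * (\<integral>\<^sup>+x0. ennreal (p0 x0) * F x1 (\<Phi> t x1 x0) \<partial>lborel) =
      (\<integral>\<^sup>+x. ennreal (p1 x1) * (ennreal (jac t x1 x) * (ennreal (p0 (\<Psi> t x1 x)) * F x1 x)) \<partial>lborel)"
      by (subst nn_integral_cmult) simp_all
    also have "\<dots> = (\<integral>\<^sup>+x. F x1 x * ennreal (joint t x x1) \<partial>lborel)"
      by (intro nn_integral_cong) (simp add: joint_def ennreal_mult mult_ac)
    finally show "ennreal (p1 x1) * (\<integral>\<^sup>+x0. ennreal (p0 x0) * F x1 (\<Phi> t x1 x0) \<partial>lborel) =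
      (\<integral>\<^sup>+x. F x1 x * ennreal (joint t x x1) \<partial>lborel)" .
  qed
  \<comment> \<open>Tonelli makes the position the outer variable, so that the minimization can be
    done separately at each \<open>x\<close>.\<close>
  also have "\<dots> = (\<integral>\<^sup>+x. \<integral>\<^sup>+x1. F x1 x * ennreal (joint t x x1) \<partial>lborel \<partial>lborel)"
    by (rule lborel_pair.Fubini') simp
  finally show ?thesis .
qed

text \<open>\<open>T\<close> is a factor of \<open>law\<close>, so a null set of times spans a null
  cylinder.\<close>

lemma AE_law_time:
  assumes "AE t in T. P t"
  shows "AE z in law. P (fst z)"
proof -
  interpret L: pair_sigma_finite T "density lborel p0 \<Otimes>\<^sub>M density lborel p1" ..
  \<comment> \<open>The exceptional set itself may fail to be measurable; it is covered by a null
    set.\<close>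
  from assms obtain N where N: "N \<in> null_sets T" "{t \<in> space T. \<not> P t} \<subseteq> N"
    by (auto simp: eventually_ae_filter)
  have [measurable]: "N \<in> sets T" using N by auto
  have "AE z in law. fst z \<notin> N"
    unfolding law_def
  proof (rule L.AE_pair_measure)
    show "AE t in T. AE y in density lborel p0 \<Otimes>\<^sub>M density lborel p1. fst (t, y) \<notin> N"
      using AE_not_in[OF N(1)] by (auto elim!: eventually_mono)
  qed measurable
  moreover have "AE z in law. fst z \<in> space T"
    by (rule AE_I2) (auto simp: law_def space_pair_measure)
  ultimately show ?thesis by eventually_elim (use N in auto)
qed

lemma nn_integral_law:
  assumes F [measurable]: "(\<lambda>(t, x1, x). F t x1 x) \<in> borel_measurable (T \<Otimes>\<^sub>M borel \<Otimes>\<^sub>M borel)"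
  shows "(\<integral>\<^sup>+(t, x0, x1). F t x1 (\<Phi> t x1 x0) \<partial>law) =
    (\<integral>\<^sup>+t. \<integral>\<^sup>+x. \<integral>\<^sup>+x1. F t x1 x * ennreal (joint t x x1) \<partial>lborel \<partial>lborel \<partial>T)"
proof -
  have "(\<lambda>z. F (fst z) (snd (snd z)) (\<Phi> (fst z) (snd (snd z)) (fst (snd z)))) \<in> borel_measurable law"
    using measurable_compose[OF _ F, of "\<lambda>z. (fst z, snd (snd z), \<Phi> (fst z) (snd (snd z)) (fst (snd z)))" law]
    by (simp add: law_def)
  then have "(\<integral>\<^sup>+(t, x0, x1). F t x1 (\<Phi> t x1 x0) \<partial>law) =
    (\<integral>\<^sup>+t. \<integral>\<^sup>+z. F t (snd z) (\<Phi> t (snd z) (fst z)) \<partial>(density lborel p0 \<Otimes>\<^sub>M density lborel p1) \<partial>T)"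
    unfolding law_def by (subst P.nn_integral_fst[symmetric]) (simp_all add: split_beta)
  also have "\<dots> = (\<integral>\<^sup>+t. \<integral>\<^sup>+x. \<integral>\<^sup>+x1. F t x1 x * ennreal (joint t x x1) \<partial>lborel \<partial>lborel \<partial>T)"
  proof (intro nn_integral_cong nn_integral_fixed_time)
    fix t assume "t \<in> space T"
    from measurable_compose_Pair1[OF this F] show "case_prod (F t) \<in> borel_measurable (borel \<Otimes>\<^sub>M borel)"
      by simp
  qed
  finally show ?thesis .
qed

text \<open>The case \<open>F = 1\<close> of \<open>nn_integral_fixed_time\<close> gives
  \<open>joint\<close> total mass one, so its marginal in \<open>x\<close> is finite almost
  everywhere.\<close>

lemma AE_joint_finite:
  assumes "t \<in> space T"
  shows "AE x in lborel. (\<integral>\<^sup>+x1. ennreal (joint t x x1) \<partial>lborel) < \<infinity>"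
proof -
  note [measurable] = measurable_const[OF assms]
  have "(\<integral>\<^sup>+x. \<integral>\<^sup>+x1. ennreal (joint t x x1) \<partial>lborel \<partial>lborel) = 1"
    using nn_integral_fixed_time[OF assms, of "\<lambda>_ _. 1"] P.emeasure_space_1 by simp
  then have "AE x in lborel. (\<integral>\<^sup>+x1. ennreal (joint t x x1) \<partial>lborel) \<noteq> \<infinity>"
    by (intro nn_integral_PInf_AE) auto
  then show ?thesis by (simp add: less_top)
qed

text \<open>The least squares inequality, applied at almost every position and integrated over
  positions and times. The additive form stays meaningful when the objectives are infinite.\<close>

lemma objective_mean_velocity:
  assumes v [measurable]: "(\<lambda>(t, x). v t x) \<in> borel_measurable (T \<Otimes>\<^sub>M borel)"
  shows "objective mean_velocity +
    (\<integral>\<^sup>+(t, x0, x1). ennreal ((norm (v t (\<Phi> t x1 x0) - mean_velocity t (\<Phi> t x1 x0)))\<^sup>2) \<partial>law)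
    \<le> objective v"
proof -
  have [measurable (raw)]: "(\<lambda>y. v (f y) (g y)) \<in> borel_measurable N"
    if "f \<in> measurable N T" "g \<in> borel_measurable N" for f g and N :: "'n measure"
    using measurable_compose[OF measurable_Pair[OF that] v] by simp
  let ?w = "\<lambda>t x1 x. W t x1 (\<Psi> t x1 x)"
  \<comment> \<open>Since \<open>\<Psi>\<close> inverts \<open>\<Phi>\<close>, the velocity can be
    rewritten as a function of the position, as the substitution requires.\<close>
  have obj: "objective u = (\<integral>\<^sup>+t. \<integral>\<^sup>+x. \<integral>\<^sup>+x1. ennreal ((norm (u t x - ?w t x1 x))\<^sup>2 * joint t x x1)
      \<partial>lborel \<partial>lborel \<partial>T)"
    if u: "(\<lambda>(t, x). u t x) \<in> borel_measurable (T \<Otimes>\<^sub>M borel)" for u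
  proof -
    have [measurable (raw)]: "(\<lambda>y. u (f y) (g y)) \<in> borel_measurable N"
      if "f \<in> measurable N T" "g \<in> borel_measurable N" for f g and N :: "'n measure"
      using measurable_compose[OF measurable_Pair[OF that] u] by simp
    have "objective u = (\<integral>\<^sup>+(t, x0, x1).
        ennreal ((norm (u t (\<Phi> t x1 x0) - ?w t x1 (\<Phi> t x1 x0)))\<^sup>2) \<partial>law)"
      unfolding objective_def law_def
      by (intro nn_integral_cong) (auto simp: space_pair_measure \<Psi>_\<Phi>)
    also have "\<dots> = (\<integral>\<^sup>+t. \<integral>\<^sup>+x. \<integral>\<^sup>+x1. ennreal ((norm (u t x - ?w t x1 x))\<^sup>2) * ennreal (joint t x x1)
      \<partial>lborel \<partial>lborel \<partial>T)"
      by (rule nn_integral_law) measurable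
    finally show ?thesis by (simp add: ennreal_mult)
  qed
  have dist: "(\<integral>\<^sup>+(t, x0, x1). ennreal ((norm (v t (\<Phi> t x1 x0) - mean_velocity t (\<Phi> t x1 x0)))\<^sup>2) \<partial>law) =
    (\<integral>\<^sup>+t. \<integral>\<^sup>+x. \<integral>\<^sup>+x1. ennreal ((norm (v t x - mean_velocity t x))\<^sup>2 * joint t x x1)
      \<partial>lborel \<partial>lborel \<partial>T)"
    by (subst nn_integral_law) (simp_all add: ennreal_mult)
  have mean: "(\<lambda>(t, x). mean_velocity t x) \<in> borel_measurable (T \<Otimes>\<^sub>M borel)" by measurable
  let ?I = "\<lambda>t x. \<integral>\<^sup>+x1. ennreal ((norm (mean_velocity t x - ?w t x1 x))\<^sup>2 * joint t x x1) \<partial>lborel"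
  let ?D = "\<lambda>t x. \<integral>\<^sup>+x1. ennreal ((norm (v t x - mean_velocity t x))\<^sup>2 * joint t x x1) \<partial>lborel"
  let ?V = "\<lambda>t x. \<integral>\<^sup>+x1. ennreal ((norm (v t x - ?w t x1 x))\<^sup>2 * joint t x x1) \<partial>lborel"
  have "(\<integral>\<^sup>+t. \<integral>\<^sup>+x. ?I t x \<partial>lborel \<partial>T) + (\<integral>\<^sup>+t. \<integral>\<^sup>+x. ?D t x \<partial>lborel \<partial>T) =
    (\<integral>\<^sup>+t. (\<integral>\<^sup>+x. ?I t x \<partial>lborel) + (\<integral>\<^sup>+x. ?D t x \<partial>lborel) \<partial>T)"
    by (rule nn_integral_add[symmetric]) measurable
  also have "\<dots> \<le> (\<integral>\<^sup>+t. \<integral>\<^sup>+x. ?V t x \<partial>lborel \<partial>T)"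
  proof (rule nn_integral_mono)
    fix t assume t: "t \<in> space T"
    then have "(\<integral>\<^sup>+x. ?I t x \<partial>lborel) + (\<integral>\<^sup>+x. ?D t x \<partial>lborel) = (\<integral>\<^sup>+x. ?I t x + ?D t x \<partial>lborel)"
      by (intro nn_integral_add[symmetric]) measurable
    also have "\<dots> \<le> (\<integral>\<^sup>+x. ?V t x \<partial>lborel)"
    proof (rule nn_integral_mono_AE)
      show "AE x in lborel. ?I t x + ?D t x \<le> ?V t x"
        using AE_joint_finite[OF t]
      proof eventually_elim
        case (elim x)
        have "(\<lambda>x1. ?w t x1 x) \<in> borel_measurable lborel" "joint t x \<in> borel_measurable lborel"
          using t by measurable
        from conditional_mean_minimizes[OF this joint_nonneg elim, of "v t x"]
        show ?case by (simp add: mean_velocity_def)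
      qed
    qed
    finally show "(\<integral>\<^sup>+x. ?I t x \<partial>lborel) + (\<integral>\<^sup>+x. ?D t x \<partial>lborel) \<le> (\<integral>\<^sup>+x. ?V t x \<partial>lborel)" .
  qed
  finally show ?thesis
    unfolding obj[OF v] obj[OF mean] dist .
qed

end

section \<open>Measurability over the open time interval\<close>

lemma borel_measurable_If_restrict_space:
  fixes f g :: "'a::topological_space \<times> 'b::topological_space \<Rightarrow> 'c::topological_space"
  assumes f: "f \<in> borel_measurable (restrict_space borel (A \<times> UNIV))"
    and A: "A \<times> UNIV \<in> sets (borel :: ('a \<times> 'b) measure)" and g: "g \<in> borel_measurable borel"
  shows "(\<lambda>z. if fst z \<in> A then f z else g z) \<in> borel_measurable borel"
proof -
  have eq: "{z. fst z \<in> A} = A \<times> UNIV" by auto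
  show ?thesis
    by (subst measurable_If_restrict_space_iff) (use assms in \<open>auto simp: eq intro: measurable_restrict_space1\<close>)
qed

lemma borel_measurable_triple_If_restrict_space:
  fixes f :: "real \<Rightarrow> real^'d \<Rightarrow> real^'d \<Rightarrow> real^'d"
  assumes f: "(\<lambda>(t, x, y). f t x y) \<in> borel_measurable (restrict_space borel ({0<..<1} \<times> UNIV))"
    and g: "(\<lambda>(t, x, y). g t x y) \<in> borel_measurable (borel \<Otimes>\<^sub>M borel \<Otimes>\<^sub>M borel)"
  shows "(\<lambda>(t, x, y). if t \<in> {0<..<1} then f t x y else g t x y)
    \<in> borel_measurable (borel \<Otimes>\<^sub>M borel \<Otimes>\<^sub>M borel)"
proof -
  have "{0<..<1::real} \<times> (UNIV :: ((real^'d) \<times> (real^'d)) set) \<in> sets borel"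
    by (intro borel_open open_Times) auto
  from borel_measurable_If_restrict_space[OF f this g[unfolded borel_prod]]
  show ?thesis unfolding borel_prod by (simp only: case_prod_beta')
qed

text \<open>Forward difference quotients in time are measurable and converge to the derivative at
  every interior time.\<close>

lemma time_deriv_measurable:
  fixes \<phi> :: "real \<Rightarrow> real^'d \<Rightarrow> real^'d \<Rightarrow> real^'d"
  assumes meas: "(\<lambda>(t, x1, x0). \<phi> t x1 x0) \<in> borel_measurable (restrict_space borel ({0<..<1} \<times> UNIV))"
    and diff: "\<And>t x1 x0. t \<in> {0<..<1} \<Longrightarrow> (\<lambda>s. \<phi> s x1 x0) differentiable (at t)"
  shows "(\<lambda>(t, x1, x0). if t \<in> {0<..<1} then time_deriv \<phi> t x1 x0 else 0)
    \<in> borel_measurable (borel \<Otimes>\<^sub>M borel \<Otimes>\<^sub>M borel)"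
proof (rule borel_measurable_LIMSEQ_metric)
  \<comment> \<open>The shifted time \<open>t + 1 / ?k\<close> can leave the interval, where nothing
    is known of \<open>\<phi>\<close>; the default zero keeps each quotient measurable.\<close>
  let ?e = "\<lambda>t x1 x0. if t \<in> {0<..<1} then \<phi> t x1 x0 else 0"
  have e: "(\<lambda>(t, x1, x0). ?e t x1 x0) \<in> borel_measurable (borel \<Otimes>\<^sub>M borel \<Otimes>\<^sub>M borel)"
    by (rule borel_measurable_triple_If_restrict_space[OF meas]) simp
  fix n
  let ?k = "real (Suc n)"
  have shift: "(\<lambda>z. (fst z + 1 / ?k, fst (snd z), snd (snd z))) \<in>
    measurable (borel \<Otimes>\<^sub>M borel \<Otimes>\<^sub>M borel) (borel \<Otimes>\<^sub>M (borel :: (real^'d) measure) \<Otimes>\<^sub>M (borel :: (real^'d) measure))"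
    by measurable
  have [measurable]: "(\<lambda>z. ?e (fst z + 1 / ?k) (fst (snd z)) (snd (snd z))) \<in> borel_measurable (borel \<Otimes>\<^sub>M borel \<Otimes>\<^sub>M borel)"
    "(\<lambda>z. ?e (fst z) (fst (snd z)) (snd (snd z))) \<in> borel_measurable (borel \<Otimes>\<^sub>M borel \<Otimes>\<^sub>M borel)"
    using measurable_compose[OF shift e] e by (simp_all only: case_prod_beta' fst_conv snd_conv)
  have "(\<lambda>z. if fst z \<in> {0<..<1} then ?k *\<^sub>R (?e (fst z + 1 / ?k) (fst (snd z)) (snd (snd z)) -
      ?e (fst z) (fst (snd z)) (snd (snd z))) else 0) \<in> borel_measurable (borel \<Otimes>\<^sub>M borel \<Otimes>\<^sub>M borel)"
    by measurable
  then show "(\<lambda>(t, x1, x0). if t \<in> {0<..<1} then ?k *\<^sub>R (?e (t + 1 / ?k) x1 x0 - ?e t x1 x0) else 0)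
      \<in> borel_measurable (borel \<Otimes>\<^sub>M borel \<Otimes>\<^sub>M borel)"
    by (simp only: case_prod_beta')
next
  fix z :: "real \<times> (real^'d) \<times> (real^'d)"
  obtain t x1 x0 where z: "z = (t, x1, x0)" by (cases z)
  let ?e = "\<lambda>t x1 x0. if t \<in> {0<..<1} then \<phi> t x1 x0 else 0"
  have "(\<lambda>n. real (Suc n) *\<^sub>R (?e (t + 1 / real (Suc n)) x1 x0 - ?e t x1 x0)) \<longlonglongrightarrow> time_deriv \<phi> t x1 x0"
    if t: "t \<in> {0<..<1}"
  proof (rule Lim_transform_eventually)
    show "(\<lambda>n. real (Suc n) *\<^sub>R (\<phi> (t + 1 / real (Suc n)) x1 x0 - \<phi> t x1 x0)) \<longlonglongrightarrow> time_deriv \<phi> t x1 x0"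
      unfolding time_deriv_def
      by (intro has_vector_derivative_sequentially vector_derivative_works[THEN iffD1] diff t)
    have "(\<lambda>n. t + 1 / real (Suc n)) \<longlonglongrightarrow> t"
      using tendsto_add[OF tendsto_const[of t] LIMSEQ_Suc[OF lim_1_over_n]] by simp
    \<comment> \<open>The interval is open, so the shifted times eventually stay inside and the
      default has no influence on the limit.\<close>
    then have "\<forall>\<^sub>F n in sequentially. t + 1 / real (Suc n) \<in> {0<..<1}"
      using t by (intro topological_tendstoD) auto
    then show "\<forall>\<^sub>F n in sequentially. real (Suc n) *\<^sub>R (\<phi> (t + 1 / real (Suc n)) x1 x0 - \<phi> t x1 x0) =
      real (Suc n) *\<^sub>R (?e (t + 1 / real (Suc n)) x1 x0 - ?e t x1 x0)"
      by eventually_elim (use t in simp)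
  qed
  then show "(\<lambda>n. (\<lambda>(t, x1, x0). if t \<in> {0<..<1} then real (Suc n) *\<^sub>R (?e (t + 1 / real (Suc n)) x1 x0 - ?e t x1 x0) else 0) z)
    \<longlonglongrightarrow> (\<lambda>(t, x1, x0). if t \<in> {0<..<1} then time_deriv \<phi> t x1 x0 else 0) z"
    unfolding z by auto
qed

section \<open>Optimality and almost everywhere uniqueness of the velocity field\<close>

theorem proposition1:
  fixes p0 p1 :: "real^'d \<Rightarrow> real"
    and \<phi> :: "real \<Rightarrow> real^'d \<Rightarrow> real^'d \<Rightarrow> real^'d"
    and v_star :: "real \<Rightarrow> real^'d \<Rightarrow> real^'d"
  assumes "prob_density p0" and "prob_density p1"
    and "interpolant \<phi>"
    and v_star_eq: "\<And>t x. v_star t x =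
        (LINT x1|lborel. (p0 (inv (\<phi> t x1) x) * \<bar>inv_jacobian_det \<phi> t x1 x\<bar> * p1 x1)
                           *\<^sub>R time_deriv \<phi> t x1 (inv (\<phi> t x1) x))
        /\<^sub>R (LINT x1|lborel. p0 (inv (\<phi> t x1) x) * \<bar>inv_jacobian_det \<phi> t x1 x\<bar> * p1 x1)"
  shows "optimal_velocity \<phi> p0 p1 v_star \<and>
     (\<forall>v. optimal_velocity \<phi> p0 p1 v \<and> cfm_objective \<phi> p0 p1 v < \<infinity> \<longrightarrow>
        (AE (t, x0, x1) in sample_law p0 p1. v t (\<phi> t x1 x0) = v_star t (\<phi> t x1 x0)))"
proof -
  \<comment> \<open>Off the open unit interval, where nothing is assumed of \<open>\<phi>\<close>, the identity map with velocity zero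
    makes all functions total and measurable.\<close>
  define I where "I = {0<..<1::real}"
  define T where "T = uniform_measure lborel {0..1::real}"
  define \<Phi> where "\<Phi> = (\<lambda>t x1 x0. if t \<in> I then \<phi> t x1 x0 else x0)"
  define \<Psi> where "\<Psi> = (\<lambda>t x1 x. if t \<in> I then inv (\<phi> t x1) x else x)"
  define W where "W = (\<lambda>t x1 x0. if t \<in> I then time_deriv \<phi> t x1 x0 else 0)"
  have bij: "bij (\<phi> t x1)" if "t \<in> I" for t x1
    using \<open>interpolant \<phi>\<close> that by (auto simp: interpolant_def I_def)
  have inv_diff: "inv (\<phi> t x1) differentiable (at x)" if "t \<in> I" for t x1 x
    using \<open>interpolant \<phi>\<close> that by (auto simp: interpolant_def I_def)
  have time_diff: "(\<lambda>s. \<phi> s x1 x0) differentiable (at t)" if "t \<in> {0<..<1}" for t x1 x0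
    using \<open>interpolant \<phi>\<close> that by (auto simp: interpolant_def)
  have \<phi>_meas: "(\<lambda>(t, x1, x0). \<phi> t x1 x0) \<in> borel_measurable (restrict_space borel ({0<..<1} \<times> UNIV))"
    and inv_meas: "(\<lambda>(t, x1, x). inv (\<phi> t x1) x) \<in> borel_measurable (restrict_space borel ({0<..<1} \<times> UNIV))"
    using \<open>interpolant \<phi>\<close> by (auto simp: interpolant_def I_def)
  have I_sets: "I \<times> UNIV \<in> sets (borel :: (real \<times> 'b::topological_space) measure)"
    by (intro borel_open open_Times) (auto simp: I_def)
  interpret prob_space T
    unfolding T_def by (rule prob_space_uniform_measure) auto
  \<comment> \<open>\<open>uniform_measure\<close> keeps the space and sigma-algebra of
    \<open>lborel\<close>: times outside the unit interval are null but still belong to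
    \<open>space T\<close>.\<close>
  have space_T [simp]: "space T = UNIV" and sets_T [measurable_cong]: "sets T = sets borel"
    by (simp_all add: T_def)
  have sets_triple: "sets (T \<Otimes>\<^sub>M borel \<Otimes>\<^sub>M borel) =
      sets (borel \<Otimes>\<^sub>M (borel :: (real^'d) measure) \<Otimes>\<^sub>M (borel :: (real^'d) measure))"
    by (intro sets_pair_measure_cong sets_T refl)
  have sets_pair: "sets (T \<Otimes>\<^sub>M (borel :: (real^'d) measure)) = sets borel"
    by (simp add: borel_prod[symmetric] sets_pair_measure_cong[OF sets_T])
  interpret F: conditional_flow T \<Phi> \<Psi> W p0 p1
  proof
    show "(\<lambda>(t, x1, x0). \<Phi> t x1 x0) \<in> borel_measurable (T \<Otimes>\<^sub>M borel \<Otimes>\<^sub>M borel)"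
      "(\<lambda>(t, x1, x). \<Psi> t x1 x) \<in> borel_measurable (T \<Otimes>\<^sub>M borel \<Otimes>\<^sub>M borel)"
      unfolding measurable_cong_sets[OF sets_triple refl] \<Phi>_def \<Psi>_def I_def
      by (rule borel_measurable_triple_If_restrict_space[OF \<phi>_meas], simp)
        (rule borel_measurable_triple_If_restrict_space[OF inv_meas], simp)
    show "(\<lambda>(t, x1, x0). W t x1 x0) \<in> borel_measurable (T \<Otimes>\<^sub>M borel \<Otimes>\<^sub>M borel)"
      unfolding measurable_cong_sets[OF sets_triple refl] W_def I_def
      by (rule time_deriv_measurable[OF \<phi>_meas time_diff])
    show "\<Psi> t x1 differentiable (at x)" for t x1 x
      using inv_diff by (cases "t \<in> I") (simp_all add: \<Psi>_def)
  qed (use bij assms(1,2) in \<open>auto simp: \<Phi>_def \<Psi>_def bij_is_inj bij_is_surj surj_f_inv_f\<close>)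
  have law: "F.law = sample_law p0 p1"
    unfolding F.law_def sample_law_def by (simp only: T_def)
  have sets_law [measurable_cong]: "sets F.law = sets (T \<Otimes>\<^sub>M borel \<Otimes>\<^sub>M borel)"
    unfolding F.law_def by (intro sets_pair_measure_cong) auto
  have "AE t in lborel. t \<in> {0..1} \<longrightarrow> t \<in> I"
    using AE_lborel_singleton[of "0::real"] AE_lborel_singleton[of "1::real"]
    by eventually_elim (auto simp: I_def)
  then have "AE t in T. t \<in> I"
    unfolding T_def by (intro AE_uniform_measureI) simp
  then have AE_I: "AE z in F.law. fst z \<in> I"
    by (rule F.AE_law_time)
  have restrict: "(\<lambda>(t, x). if t \<in> I then v t x else 0) \<in> borel_measurable (T \<Otimes>\<^sub>M borel)"
    if "vector_field v" for v :: "real \<Rightarrow> real^'d \<Rightarrow> real^'d"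
    using borel_measurable_If_restrict_space[OF that[unfolded vector_field_def, folded I_def] I_sets, of "\<lambda>_. 0"]
    unfolding measurable_cong_sets[OF sets_pair refl] case_prod_beta' by simp
  \<comment> \<open>Almost all sampled times lie in \<open>I\<close>, where \<open>\<Phi>\<close>
    and \<open>W\<close> agree with \<open>\<phi>\<close> and its time derivative.\<close>
  have objective: "cfm_objective \<phi> p0 p1 v = F.objective u"
    if "\<And>t x. t \<in> I \<Longrightarrow> u t x = v t x" for u v
    unfolding cfm_objective_def F.objective_def law[symmetric]
    using AE_I by (intro nn_integral_cong_AE, eventually_elim)
      (auto simp: that \<Phi>_def W_def case_prod_beta')
  have mean: "F.mean_velocity t x = v_star t x" if "t \<in> I" for t x
    using that unfolding F.mean_velocity_def F.joint_def F.jac_def v_star_eq inv_jacobian_det_def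
    by (simp add: \<Psi>_def W_def)
  \<comment> \<open>Measurability is inherited from \<open>F.mean_velocity\<close>, with which
    \<open>v_star\<close> agrees at times in \<open>I\<close>.\<close>
  have "vector_field v_star"
    unfolding vector_field_def I_def[symmetric]
  proof (subst measurable_cong)
    show "(\<lambda>(t, x). v_star t x) z = (\<lambda>(t, x). F.mean_velocity t x) z"
      if "z \<in> space (restrict_space borel (I \<times> UNIV))" for z
      using that by (auto simp: space_restrict_space mean)
    have "(\<lambda>(t, x). F.mean_velocity t x) \<in> borel_measurable (T \<Otimes>\<^sub>M borel)"
      by measurable
    then show "(\<lambda>(t, x). F.mean_velocity t x) \<in> borel_measurable (restrict_space borel (I \<times> UNIV))"
      unfolding measurable_cong_sets[OF sets_pair refl] by (rule measurable_restrict_space1)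
  qed
  have gap: "cfm_objective \<phi> p0 p1 v_star + (\<integral>\<^sup>+(t, x0, x1). ennreal ((norm
        ((if t \<in> I then v t (\<Phi> t x1 x0) else 0) - F.mean_velocity t (\<Phi> t x1 x0)))\<^sup>2) \<partial>F.law)
      \<le> cfm_objective \<phi> p0 p1 v"
    if "vector_field v" for v
    using F.objective_mean_velocity[OF restrict[OF that]]
      objective[of F.mean_velocity v_star, OF mean] objective[of "\<lambda>t x. if t \<in> I then v t x else 0" v]
    by simp
  have optimal: "optimal_velocity \<phi> p0 p1 v_star"
    unfolding optimal_velocity_def is_arg_min_def
  proof (intro conjI notI)
    assume "\<exists>v. vector_field v \<and> cfm_objective \<phi> p0 p1 v < cfm_objective \<phi> p0 p1 v_star"
    then obtain v where v: "vector_field v" "cfm_objective \<phi> p0 p1 v < cfm_objective \<phi> p0 p1 v_star" by blast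
    have "cfm_objective \<phi> p0 p1 v_star \<le> cfm_objective \<phi> p0 p1 v"
      by (rule order_trans[OF _ gap[OF v(1)]]) simp
    with v(2) show False by simp
  qed fact
  moreover have "AE (t, x0, x1) in sample_law p0 p1. v t (\<phi> t x1 x0) = v_star t (\<phi> t x1 x0)"
    if v: "optimal_velocity \<phi> p0 p1 v" and fin: "cfm_objective \<phi> p0 p1 v < \<infinity>" for v
  proof -
    let ?d = "\<lambda>z. (if fst z \<in> I then v (fst z) (\<Phi> (fst z) (snd (snd z)) (fst (snd z))) else 0) -
      F.mean_velocity (fst z) (\<Phi> (fst z) (snd (snd z)) (fst (snd z)))"
    have vf: "vector_field v" and le: "cfm_objective \<phi> p0 p1 v \<le> cfm_objective \<phi> p0 p1 v_star"
      using v \<open>vector_field v_star\<close> by (auto simp: optimal_velocity_def is_arg_min_def not_less)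
    have "cfm_objective \<phi> p0 p1 v_star + (\<integral>\<^sup>+z. ennreal ((norm (?d z))\<^sup>2) \<partial>F.law) \<le> cfm_objective \<phi> p0 p1 v_star"
      using order_trans[OF gap[OF vf] le] by (simp add: case_prod_beta')
    \<comment> \<open>Finiteness permits cancelling the minimum. If every field had infinite
      objective, every vector field would be a minimizer and uniqueness could fail.\<close>
    moreover have "cfm_objective \<phi> p0 p1 v_star < \<infinity>"
      using optimal vf fin by (auto simp: optimal_velocity_def is_arg_min_def not_less intro: le_less_trans)
    ultimately have zero: "(\<integral>\<^sup>+z. ennreal ((norm (?d z))\<^sup>2) \<partial>F.law) = 0"
      using ennreal_add_left_cancel_le[of "cfm_objective \<phi> p0 p1 v_star" _ 0] by auto
    have \<Phi>_law [measurable]: "(\<lambda>z. \<Phi> (fst z) (snd (snd z)) (fst (snd z))) \<in> borel_measurable F.law"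
      by measurable
    have "(\<lambda>z. (fst z, \<Phi> (fst z) (snd (snd z)) (fst (snd z)))) \<in> measurable F.law (T \<Otimes>\<^sub>M borel)"
      by measurable
    from measurable_compose[OF this restrict[OF vf]]
    have "?d \<in> borel_measurable F.law" unfolding prod.case by measurable
    then have "AE z in F.law. ennreal ((norm (?d z))\<^sup>2) = 0"
      using zero by (subst (asm) nn_integral_0_iff_AE) auto
    \<comment> \<open>At times in \<open>I\<close>, a vanishing \<open>?d\<close> is exactly the
      equality of \<open>v\<close> and \<open>v_star\<close> at the sampled position.\<close>
    with AE_I show ?thesis
      unfolding law[symmetric]
      by eventually_elim (auto simp: mean \<Phi>_def)
  qed
  ultimately show ?thesis by blast
qed

end
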